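(* Let $m:\mathbb N\to\mathbb N$. Then the limiting probability, as $n\to\infty$, that in a uniformly random assignment of $m(n)$ drivers to $n$ spaces all spaces are occupied is $$\lim_{n\to\infty}\frac{\mathrm{cp}\big(n,m(n),m(n)-n\big)}{n^{m(n)}}=\begin{cases}0 & \text{if }\lim_{n\to\infty}m(n)/n\le 1,\\ 1 & \text{if }\lim_{n\to\infty}m(n)/n=\infty.\end{cases}$$
   Context: Car parking problem: a car park has $n$ spaces in a line, numbered $1,\dots,n$, and $m$ drivers arrive one after the other. Each driver has chosen a preferred space, so an assignment is a function $f:\{1,\dots,m\}\to\{1,\dots,n\}$, and there are $n^m$ assignments; a random assignment is one chosen uniformly among these. Each arriving driver parks in the chosen space if it is free; otherwise the driver takes the first free space with a larger number, if there is one; if there is none, the driver fails to park and goes home. $\mathrm{cp}(n,m,k)$ denotes the number of assignments for which exactly $k$ drivers fail to park; it is $0$ if $k<0$. All spaces end up occupied if and only if exactly $m-n$ drivers fail to park. In the first case the condition means that the limit of $m(n)/n$ exists and is at most $1$. *)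

theory Defs
  imports "HOL-Probability.Probability"
begin

text \<open>
  A car park has spaces \<open>1, \<dots>, n\<close>; drivers \<open>1, \<dots>, m\<close> arrive in this order.
\<close>

definition assignments :: "nat \<Rightarrow> nat \<Rightarrow> (nat \<Rightarrow> nat) set" where
  "assignments n m = ({1..m} \<rightarrow>\<^sub>E {1..n})"

text \<open>
  The space taken by a driver who prefers space \<open>a\<close> when the spaces in \<open>S\<close> are occupied;
  \<open>None\<close> if the driver goes home.
\<close>

definition parking_space :: "nat \<Rightarrow> nat set \<Rightarrow> nat \<Rightarrow> nat option" where
  "parking_space n S a =
     (if a \<notin> S then Some a
      else if {a<..n} - S \<noteq> {} then Some (Min ({a<..n} - S))
      else None)"

text \<open>The set of occupied spaces after the first \<open>j\<close> drivers have arrived.\<close>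

primrec occupied :: "nat \<Rightarrow> (nat \<Rightarrow> nat) \<Rightarrow> nat \<Rightarrow> nat set" where
  "occupied n f 0 = {}"
| "occupied n f (Suc j) =
     (case parking_space n (occupied n f j) (f (Suc j)) of
        None \<Rightarrow> occupied n f j
      | Some s \<Rightarrow> insert s (occupied n f j))"

definition failing_drivers :: "nat \<Rightarrow> nat \<Rightarrow> (nat \<Rightarrow> nat) \<Rightarrow> nat set" where
  "failing_drivers n m f =
     {j \<in> {1..m}. parking_space n (occupied n f (j - 1)) (f j) = None}"

text \<open>
  The number \<open>k\<close> is an integer because \<open>k = m - n\<close> may be negative; the value is then \<open>0\<close>.
\<close>

definition cp :: "nat \<Rightarrow> nat \<Rightarrow> int \<Rightarrow> nat" where
  "cp n m k = card {f \<in> assignments n m. int (card (failing_drivers n m f)) = k}"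

end

theory Submission
  imports Defs "HOL-Real_Asymp.Real_Asymp"
begin

text \<open>
  Whether the car park fills up can be read off the preferences alone: it does if and only if, for
  every \<open>i\<close>, at least \<open>i\<close> drivers prefer one of the first \<open>i\<close> spaces (\<open>all_occupied_iff\<close>). In a random
  assignment the number of drivers preferring a given space is roughly Poisson with mean \<open>m/n\<close>, so
  the question is whether a walk with steps of mean \<open>m/n - 1\<close>, bounded below by \<open>-1\<close>, stays
  nonnegative. With drift at most \<open>0\<close> the probability of this should vanish in the limit, and with
  drift tending to infinity it should tend to \<open>1\<close>. Both facts have finite counting proofs.

  For the limit \<open>0\<close>, suppose first that the walk must stay strictly positive, over \<open>N\<close> spaces
  arranged in a circle. A start from which the walk stays strictly positive for a whole round has a
  value below that of every later time up to one round, so different such starts in one round have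
  different values, all within a window of length \<open>|A| - N\<close>, the total gain of a round with \<open>|A|\<close>
  drivers (\<open>card_strict_starts_le\<close>). By rotational symmetry the strict condition therefore has
  probability at most \<open>(|A| - N)/N\<close> (\<open>card_overfull_le\<close>). The weak condition is reduced to the strict
  one by putting one more space in front, preferred by exactly two additional drivers
  (\<open>choose_mult_card_filling_le\<close>). If \<open>m \<ge> n\<close> and \<open>m/n\<close> is bounded, a given space is preferred by
  exactly two drivers with probability bounded away from \<open>0\<close>, so this costs only a constant factor,
  and an upper bound of order \<open>m/n - 1 + 1/n\<close> remains (\<open>filling_ratio_le\<close>).

  For the limit \<open>1\<close>, an exponential moment bounds the probability that fewer than \<open>i\<close> drivers prefer
  the first \<open>i\<close> spaces by \<open>q\<^sup>i\<close> with \<open>q = 2 exp (- m/(2n))\<close> (\<open>card_few_preferences_le\<close>), and the sum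
  of these over \<open>i\<close> is at most \<open>q/(1 - q)\<close>, which vanishes as \<open>m/n\<close> grows (\<open>filling_ratio_ge\<close>).
\<close>

(* Without this the simplifier turns the index sets {1..m} into {Suc 0..m}, to which the lemmas
   about {1..m} no longer apply. *)
declare One_nat_def [simp del]

section \<open>Full car parks\<close>

text \<open>
  The drivers form an arbitrary set because only their number matters for the cardinality; this
  allows two drivers to be removed from \<open>{1..m+2}\<close> without renumbering the others.
\<close>

definition filling :: "'a set \<Rightarrow> nat \<Rightarrow> ('a \<Rightarrow> nat) set" where
  "filling A n = {f \<in> A \<rightarrow>\<^sub>E {1..n}. \<forall>i\<in>{1..n}. i \<le> card {j\<in>A. f j \<le> i}}"

lemma parking_space_SomeD:
  assumes "parking_space n S a = Some s" "a \<in> {1..n}"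
  shows "s \<in> {a..n} - S"
proof (cases "a \<in> S")
  case True
  then have ne: "{a<..n} - S \<noteq> {}" and s: "s = Min ({a<..n} - S)"
    using assms by (auto simp: parking_space_def split: if_splits)
  have "s \<in> {a<..n} - S"
    unfolding s using ne by (intro Min_in) auto
  then show ?thesis by auto
next
  case False
  then show ?thesis using assms by (auto simp: parking_space_def)
qed

lemma parking_space_free_above:
  assumes "a \<le> s" "s \<le> n" "s \<notin> S"
  obtains t where "parking_space n S a = Some t" "t \<le> s"
proof (cases "a \<in> S")
  case True
  then have mem: "s \<in> {a<..n} - S"
    using assms by (cases "a = s") auto
  then have "Min ({a<..n} - S) \<le> s"
    by (intro Min_le) auto
  moreover have "parking_space n S a = Some (Min ({a<..n} - S))"
    using True mem by (auto simp: parking_space_def)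
  ultimately show ?thesis using that by blast
next
  case False
  then show ?thesis using that assms by (auto simp: parking_space_def)
qed

lemma finite_occupied [simp]: "finite (occupied n f j)"
  by (induction j) (auto split: option.split)

lemma occupied_subset:
  assumes "f \<in> {1..m} \<rightarrow> {1..n}" "j \<le> m"
  shows "occupied n f j \<subseteq> {1..n}"
  using assms(2)
proof (induction j)
  case (Suc j)
  then have "f (Suc j) \<in> {1..n}" using assms(1) by auto
  then show ?case
    using Suc parking_space_SomeD[of n "occupied n f j" "f (Suc j)"]
    by (auto split: option.split)
qed auto

lemma card_occupied_plus_failing:
  assumes "f \<in> {1..m} \<rightarrow> {1..n}" "j \<le> m"
  shows "card (occupied n f j) + card (failing_drivers n j f) = j"
  using assms(2)
proof (induction j)
  case 0
  then show ?case by (simp add: failing_drivers_def)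
next
  case (Suc j)
  then have pref: "f (Suc j) \<in> {1..n}" using assms(1) by auto
  let ?p = "parking_space n (occupied n f j) (f (Suc j))"
  have fin: "finite (failing_drivers n j f)" and new: "Suc j \<notin> failing_drivers n j f"
    by (auto simp: failing_drivers_def)
  have step: "failing_drivers n (Suc j) f =
      (if ?p = None then insert (Suc j) (failing_drivers n j f) else failing_drivers n j f)"
    by (auto simp: failing_drivers_def le_Suc_eq)
  show ?case
  proof (cases ?p)
    case None
    then show ?thesis using Suc fin new step by simp
  next
    case (Some s)
    then have "s \<notin> occupied n f j"
      using parking_space_SomeD[OF Some pref] by auto
    then show ?thesis using Suc Some step by simp
  qed
qed

lemma preferences_up_to_Suc:
  fixes f :: "nat \<Rightarrow> nat"
  shows "card {k\<in>{1..Suc j}. f k \<le> i} = card {k\<in>{1..j}. f k \<le> i} + (if f (Suc j) \<le> i then 1 else 0)"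
proof -
  have "{k\<in>{1..Suc j}. f k \<le> i} =
      (if f (Suc j) \<le> i then insert (Suc j) {k\<in>{1..j}. f k \<le> i} else {k\<in>{1..j}. f k \<le> i})"
    by (auto simp: le_Suc_eq)
  then show ?thesis by simp
qed

text \<open>
  Nobody parks before the preferred space, so whoever stands in the first \<open>i\<close> spaces wanted one of
  them.
\<close>

lemma card_occupied_le_preferences:
  assumes "f \<in> {1..m} \<rightarrow> {1..n}" "j \<le> m"
  shows "card (occupied n f j \<inter> {1..i}) \<le> card {k\<in>{1..j}. f k \<le> i}"
  using assms(2)
proof (induction j)
  case 0
  then show ?case by simp
next
  case (Suc j)
  then have pref: "f (Suc j) \<in> {1..n}" using assms(1) by auto
  show ?case
  proof (cases "parking_space n (occupied n f j) (f (Suc j))")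
    case None
    then show ?thesis unfolding preferences_up_to_Suc using Suc by simp
  next
    case (Some s)
    then have "f (Suc j) \<le> s" using parking_space_SomeD[OF Some pref] by auto
    then show ?thesis
      unfolding preferences_up_to_Suc
      using Suc Some by (auto simp: Int_insert_left card_insert_if)
  qed
qed

text \<open>
  A driver never passes a free space. As long as \<open>s\<close> is free, everybody who preferred a space up to
  \<open>s\<close> has therefore found one there, and nobody else has entered this part of the car park.
\<close>

lemma card_occupied_below_free_space:
  assumes "f \<in> {1..m} \<rightarrow> {1..n}" "j \<le> m" "s \<le> n" "s \<notin> occupied n f j"
  shows "card (occupied n f j \<inter> {1..s}) = card {k\<in>{1..j}. f k \<le> s}"
  using assms(2,4)
proof (induction j)
  case 0
  then show ?case by simp
next
  case (Suc j)
  then have pref: "f (Suc j) \<in> {1..n}" using assms(1) by auto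
  let ?p = "parking_space n (occupied n f j) (f (Suc j))"
  have free: "s \<notin> occupied n f j" using Suc.prems by (auto split: option.splits)
  show ?case
  proof (cases "f (Suc j) \<le> s")
    case True
    obtain t where t: "?p = Some t" "t \<le> s"
      using parking_space_free_above[OF True assms(3) free] .
    then have "t \<in> {1..s}" "t \<notin> occupied n f j"
      using parking_space_SomeD[OF t(1) pref] pref by auto
    then show ?thesis
      unfolding preferences_up_to_Suc
      using Suc free t True by (simp add: Int_insert_left)
  next
    case False
    then have "occupied n f (Suc j) \<inter> {1..s} = occupied n f j \<inter> {1..s}"
      using parking_space_SomeD[of n "occupied n f j" "f (Suc j)", OF _ pref]
      by (auto split: option.splits)
    then show ?thesis unfolding preferences_up_to_Suc using Suc free False by simp
  qed
qed

lemma all_occupied_iff: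
  assumes "f \<in> {1..m} \<rightarrow> {1..n}"
  shows "occupied n f m = {1..n} \<longleftrightarrow> (\<forall>i\<in>{1..n}. i \<le> card {j\<in>{1..m}. f j \<le> i})"
proof
  assume full: "occupied n f m = {1..n}"
  show "\<forall>i\<in>{1..n}. i \<le> card {j\<in>{1..m}. f j \<le> i}"
  proof
    fix i assume "i \<in> {1..n}"
    then have "occupied n f m \<inter> {1..i} = {1..i}" using full by auto
    then show "i \<le> card {j\<in>{1..m}. f j \<le> i}"
      using card_occupied_le_preferences[OF assms order_refl, of i] by simp
  qed
next
  assume many: "\<forall>i\<in>{1..n}. i \<le> card {j\<in>{1..m}. f j \<le> i}"
  \<comment> \<open>If \<open>s\<close> were free, the first \<open>s\<close> spaces would hold at least \<open>s\<close> cars with only \<open>s - 1\<close> of them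
    in use.\<close>
  have "s \<in> occupied n f m" if s: "s \<in> {1..n}" for s
  proof (rule ccontr)
    assume free: "s \<notin> occupied n f m"
    then have "card (occupied n f m \<inter> {1..s}) = card {j\<in>{1..m}. f j \<le> s}"
      using card_occupied_below_free_space[OF assms] s by auto
    moreover have "card (occupied n f m \<inter> {1..s}) \<le> card {1..<s}"
    proof (rule card_mono)
      show "occupied n f m \<inter> {1..s} \<subseteq> {1..<s}"
        using free by (auto simp: less_le)
    qed simp
    ultimately show False using many s by fastforce
  qed
  then show "occupied n f m = {1..n}" using occupied_subset[OF assms order_refl] by auto
qed

lemma all_occupied_iff_failing:
  assumes "f \<in> {1..m} \<rightarrow> {1..n}"
  shows "occupied n f m = {1..n} \<longleftrightarrow> int (card (failing_drivers n m f)) = int m - int n"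
proof -
  have "occupied n f m = {1..n} \<longleftrightarrow> card (occupied n f m) = n"
    using card_subset_eq[OF _ occupied_subset[OF assms order_refl]] by auto
  then show ?thesis using card_occupied_plus_failing[OF assms order_refl] by linarith
qed

lemma filling_eq_all_occupied:
  "filling {1..m} n = {f \<in> assignments n m. occupied n f m = {1..n}}"
  unfolding filling_def assignments_def using all_occupied_iff
  by (auto simp: PiE_iff Pi_iff)

lemma cp_eq_card_filling: "cp n m (int m - int n) = card (filling {1..m} n)"
proof -
  have "filling {1..m} n = {f \<in> assignments n m. int (card (failing_drivers n m f)) = int m - int n}"
    unfolding filling_eq_all_occupied assignments_def
    using all_occupied_iff_failing by (auto simp: PiE_iff Pi_iff)
  then show ?thesis by (simp add: cp_def)
qed

lemma card_assignments: "card (assignments n m) = n ^ m"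
  by (simp add: assignments_def card_PiE)

lemma finite_filling [simp]: "finite A \<Longrightarrow> finite (filling A n)"
  by (simp add: filling_def finite_PiE)

lemma prob_all_occupied:
  assumes "n \<ge> 1"
  shows "measure_pmf.prob (pmf_of_set (assignments n m)) {f. occupied n f m = {1..n}}
       = real (card (filling {1..m} n)) / real n ^ m"
proof -
  have fin: "finite (assignments n m)"
    by (simp add: assignments_def finite_PiE)
  moreover have "assignments n m \<noteq> {}"
    using assms by (auto simp: assignments_def PiE_eq_empty_iff)
  moreover have "assignments n m \<inter> {f. occupied n f m = {1..n}} = filling {1..m} n"
    by (auto simp: filling_eq_all_occupied)
  ultimately show ?thesis
    by (simp add: measure_pmf_of_set card_assignments)
qed

section \<open>The upper bound by rotation\<close>

text \<open>
  This is the cycle lemma for the walk \<open>S\<close> with steps \<open>c u - 1\<close>. From a start \<open>s\<close> of the kind counted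
  here, \<open>S\<close> exceeds \<open>S s\<close> for one whole period. Hence \<open>S\<close> takes distinct values at these starts, and
  compared with the first one, \<open>s\<^sub>0\<close>, all values lie in the window from \<open>S s\<^sub>0\<close> to
  \<open>S (s\<^sub>0 + N) = S s\<^sub>0 + S N\<close>.
\<close>

lemma card_strict_starts_le:
  fixes c :: "nat \<Rightarrow> nat"
  assumes periodic: "\<And>u. c (u + N) = c u"
  shows "card {s\<in>{..<N}. \<forall>t\<in>{1..N}. t < (\<Sum>u=s..<s+t. c u)} \<le> (\<Sum>u<N. c u) - N"
proof -
  define S where "S t = (\<Sum>u<t. int (c u)) - int t" for t
  define G where "G = {s\<in>{..<N}. \<forall>t\<in>{1..N}. t < (\<Sum>u=s..<s+t. c u)}"
  have S_add: "S (s + t) = S s + int (\<Sum>u=s..<s+t. c u) - int t" for s t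
  proof -
    have "{..<s+t} = {..<s} \<union> {s..<s+t}" "{..<s} \<inter> {s..<s+t} = {}" by auto
    then have "(\<Sum>u<s+t. int (c u)) = (\<Sum>u<s. int (c u)) + (\<Sum>u=s..<s+t. int (c u))"
      by (simp add: sum.union_disjoint)
    then show ?thesis by (simp add: S_def)
  qed
  have S_period: "S (s + N) = S s + S N" for s
  proof -
    have "(\<Sum>u=s..<s+N. c u) = (\<Sum>u<N. c u)"
    proof (induction s)
      case 0
      then show ?case by (simp add: atLeast0LessThan)
    next
      case (Suc s)
      show ?case
      proof (cases "N = 0")
        case False
        then have "(\<Sum>u=s..<s+N. c u) = c s + (\<Sum>u=Suc s..<s+N. c u)"
          by (simp add: sum.atLeast_Suc_lessThan)
        moreover have "(\<Sum>u=Suc s..<Suc s+N. c u) = (\<Sum>u=Suc s..<s+N. c u) + c s"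
          using False periodic by simp
        ultimately show ?thesis using Suc by simp
      qed simp
    qed
    then show ?thesis using S_add[of s N] by (simp add: S_def)
  qed
  have rise: "S s < S t" if "s \<in> G" "s < t" "t \<le> s + N" for s t
  proof -
    have "t - s \<in> {1..N}" using that by auto
    then have "t - s < (\<Sum>u=s..<s+(t-s). c u)" using that(1) unfolding G_def by blast
    then have "int (t - s) < int (\<Sum>u=s..<s+(t-s). c u)" by (simp only: of_nat_less_iff)
    moreover have "s + (t - s) = t" using that(2) by simp
    ultimately show ?thesis using S_add[of s "t - s"] by (simp del: of_nat_sum)
  qed
  have below: "s < N" if "s \<in> G" for s
    using that by (simp add: G_def)
  have "card G \<le> nat (S N)"
  proof (cases "G = {}")
    case False
    have "finite G" by (simp add: G_def)
    define s0 where "s0 = Min G"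
    have s0: "s0 \<in> G" and least: "\<And>s. s \<in> G \<Longrightarrow> s0 \<le> s"
      using \<open>finite G\<close> False by (simp_all add: s0_def)
    have "inj_on S G"
    proof (rule linorder_inj_onI)
      fix s t assume "s < t" "s \<in> G" "t \<in> G"
      then show "S s \<noteq> S t" using rise[of s t] below[of t] by simp
    qed auto
    then have "card G = card (S ` G)" by (simp add: card_image)
    also have "\<dots> \<le> card {S s0..<S s0 + S N}"
    proof (rule card_mono)
      show "S ` G \<subseteq> {S s0..<S s0 + S N}"
      proof safe
        fix s assume s: "s \<in> G"
        have "S s0 \<le> S s"
          using rise[OF s0, of s] least[OF s] below[OF s] by (cases "s = s0") auto
        moreover have "S s < S (s0 + N)"
          using rise[OF s, of "s0 + N"] least[OF s] below[OF s] by auto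
        ultimately show "S s \<in> {S s0..<S s0 + S N}" by (simp add: S_period)
      qed
    qed simp
    finally show ?thesis by simp
  qed simp
  also have "nat (S N) = (\<Sum>u<N. c u) - N"
    by (simp add: S_def nat_diff_distrib' flip: of_nat_sum)
  finally show ?thesis by (simp add: G_def)
qed

text \<open>
  The spaces are numbered from \<open>0\<close> here, so that they are the residues modulo \<open>N\<close> and can be rotated,
  and so that space \<open>0\<close> can be put in front of \<open>{1..n}\<close>. This is the strict version of \<open>filling\<close>.
\<close>

definition overfull :: "'a set \<Rightarrow> nat \<Rightarrow> ('a \<Rightarrow> nat) set" where
  "overfull A N = {g \<in> A \<rightarrow>\<^sub>E {..<N}. \<forall>t\<in>{1..N}. t < card {j\<in>A. g j < t}}"

lemma card_preimage_eq_sum: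
  assumes "finite A" "finite T"
  shows "card {j\<in>A. g j \<in> T} = (\<Sum>u\<in>T. card {j\<in>A. g j = u})"
proof -
  have "{j\<in>A. g j \<in> T} = (\<Union>u\<in>T. {j\<in>A. g j = u})" by auto
  also have "card \<dots> = (\<Sum>u\<in>T. card {j\<in>A. g j = u})"
    using assms by (intro card_UN_disjoint) auto
  finally show ?thesis .
qed

text \<open>
  Rotating an overfull assignment by \<open>s\<close> gives one that is overfull when the circle is read from \<open>s\<close>
  on. So for each of the \<open>N\<close> starting points there are at least as many assignments that are good
  from there, while by the cycle lemma every single assignment has at most \<open>|A| - N\<close> good starts.
\<close>

lemma card_overfull_le:
  assumes "finite A"
  shows "N * card (overfull A N) \<le> (card A - N) * N ^ card A"
proof (cases "N = 0")
  case False
  then have "N > 0" by simp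
  define E where "E = (A \<rightarrow>\<^sub>E {..<N})"
  define c where "c g u = card {j\<in>A. g j = u mod N}" for g :: "'a \<Rightarrow> nat" and u
  define good where "good s g \<longleftrightarrow> (\<forall>t\<in>{1..N}. t < (\<Sum>u=s..<s+t. c g u))" for s g
  have finE: "finite E" using assms by (simp add: E_def finite_PiE)
  have "card (overfull A N) \<le> card {g\<in>E. good s g}" if "s < N" for s
  proof -
    define rot where "rot g = (\<lambda>j\<in>A. (g j + s) mod N)" for g :: "'a \<Rightarrow> nat"
    have mod_inj: "x = y" if "(x + s) mod N = (y + s) mod N" "x < N" "y < N" for x y
    proof -
      have "(x + s + (N - s)) mod N = (y + s + (N - s)) mod N"
        using that(1) by (metis mod_add_left_eq)
      then show ?thesis using that \<open>s < N\<close> by simp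
    qed
    have c_rot: "c (rot g) (s + u) = card {j\<in>A. g j = u}" if "g \<in> E" "u < N" for g u
    proof -
      have "(g j + s) mod N = (s + u) mod N \<longleftrightarrow> g j = u" if "j \<in> A" for j
        using mod_inj[of "g j" u] \<open>g \<in> E\<close> \<open>u < N\<close> that by (auto simp: E_def add.commute)
      then have "{j\<in>A. rot g j = (s + u) mod N} = {j\<in>A. g j = u}"
        by (auto simp: rot_def)
      then show ?thesis by (simp add: c_def)
    qed
    have sum_rot: "(\<Sum>u=s..<s+t. c (rot g) u) = card {j\<in>A. g j < t}" if "g \<in> E" "t \<le> N" for g t
    proof -
      have "(\<Sum>u=s..<s+t. c (rot g) u) = (\<Sum>u<t. c (rot g) (s + u))"
        using sum.shift_bounds_nat_ivl[of "c (rot g)" 0 s t]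
        by (simp add: atLeast0LessThan add.commute[of s])
      also have "\<dots> = (\<Sum>u<t. card {j\<in>A. g j = u})"
        using that by (intro sum.cong) (auto simp: c_rot)
      also have "\<dots> = card {j\<in>A. g j < t}"
        using card_preimage_eq_sum[OF assms, of "{..<t}" g] by simp
      finally show ?thesis .
    qed
    have inj: "inj_on rot E"
    proof (rule inj_onI)
      fix g h assume g: "g \<in> E" and h: "h \<in> E" and eq: "rot g = rot h"
      show "g = h"
      proof (rule PiE_ext)
        show "g \<in> A \<rightarrow>\<^sub>E {..<N}" "h \<in> A \<rightarrow>\<^sub>E {..<N}" using g h by (simp_all add: E_def)
        fix j assume j: "j \<in> A"
        then have "(g j + s) mod N = (h j + s) mod N"
          using fun_cong[OF eq, of j] by (simp add: rot_def)
        moreover have "g j < N" "h j < N" using g h j by (auto simp: E_def)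
        ultimately show "g j = h j" by (rule mod_inj)
      qed
    qed
    have sub: "overfull A N \<subseteq> E" by (auto simp: overfull_def E_def)
    show ?thesis
    proof (rule card_inj_on_le)
      show "inj_on rot (overfull A N)" using inj sub by (rule inj_on_subset)
      show "rot ` overfull A N \<subseteq> {g\<in>E. good s g}"
      proof clarify
        fix g assume g: "g \<in> overfull A N"
        have "rot g \<in> E" using \<open>N > 0\<close> by (simp add: rot_def E_def)
        moreover have "good s (rot g)"
          unfolding good_def
        proof
          fix t assume t: "t \<in> {1..N}"
          then have "t < card {j\<in>A. g j < t}" using g unfolding overfull_def by blast
          then show "t < (\<Sum>u=s..<s+t. c (rot g) u)" using sum_rot[of g t] g sub t by auto
        qed
        ultimately show "rot g \<in> E \<and> good s (rot g)" by blast
      qed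
    qed (use finE in simp)
  qed
  then have "(\<Sum>s<N. card (overfull A N)) \<le> (\<Sum>s<N. card {g\<in>E. good s g})"
    by (intro sum_mono) auto
  also have "\<dots> = (\<Sum>g\<in>E. card {s\<in>{..<N}. good s g})"
    using finE by (intro sum_multicount_gen) auto
  also have "\<dots> \<le> (\<Sum>g\<in>E. card A - N)"
  proof (rule sum_mono)
    fix g assume g: "g \<in> E"
    have "(\<Sum>u<N. c g u) = (\<Sum>u<N. card {j\<in>A. g j = u})" by (simp add: c_def)
    also have "\<dots> = card {j\<in>A. g j \<in> {..<N}}"
      using card_preimage_eq_sum[OF assms, of "{..<N}" g] by simp
    also have "{j\<in>A. g j \<in> {..<N}} = A" using g by (auto simp: E_def)
    finally have "(\<Sum>u<N. c g u) = card A" .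
    then show "card {s\<in>{..<N}. good s g} \<le> card A - N"
      using card_strict_starts_le[of "c g" N] by (simp add: good_def c_def)
  qed
  finally show ?thesis
    using assms by (simp add: E_def card_PiE mult.commute)
qed simp

lemma card_filling_le:
  assumes "finite A" "finite B" "card A = card B"
  shows "card (filling A n) \<le> card (filling B n)"
proof -
  obtain h where h: "bij_betw h B A"
    using assms finite_same_card_bij by metis
  define relabel where "relabel f = (\<lambda>j\<in>B. f (h j))" for f :: "'a \<Rightarrow> nat"
  have "inj_on relabel (filling A n)"
  proof (rule inj_onI)
    fix f g assume f: "f \<in> filling A n" and g: "g \<in> filling A n" and eq: "relabel f = relabel g"
    show "f = g"
    proof (rule PiE_ext)
      show "f \<in> A \<rightarrow>\<^sub>E {1..n}" "g \<in> A \<rightarrow>\<^sub>E {1..n}" using f g by (simp_all add: filling_def)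
      fix a assume "a \<in> A"
      then obtain j where "j \<in> B" "a = h j" using h by (auto simp: bij_betw_def)
      then show "f a = g a" using fun_cong[OF eq, of j] by (simp add: relabel_def)
    qed
  qed
  moreover have "relabel f \<in> filling B n" if f: "f \<in> filling A n" for f
  proof -
    have "card {j\<in>B. relabel f j \<le> i} = card {a\<in>A. f a \<le> i}" for i
    proof (rule bij_betw_same_card)
      show "bij_betw h {j\<in>B. relabel f j \<le> i} {a\<in>A. f a \<le> i}"
        using h by (auto simp: bij_betw_def relabel_def intro: inj_on_subset)
    qed
    moreover have "relabel f \<in> B \<rightarrow>\<^sub>E {1..n}"
      using f h by (auto simp: relabel_def filling_def bij_betw_def)
    ultimately show ?thesis using f by (simp add: filling_def)
  qed
  ultimately show ?thesis
    using assms by (intro card_inj_on_le[of relabel]) auto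
qed

text \<open>
  A pair of drivers and a filling assignment of the other \<open>m\<close> drivers to \<open>{1..n}\<close> are combined by
  sending the pair to the new space \<open>0\<close>. The pair is recovered as the drivers who prefer space \<open>0\<close>.
  Among the first \<open>t\<close> spaces \<open>0, \<dots>, t - 1\<close> there are then \<open>2 + (t - 1)\<close> preferences or more; the second
  driver of the pair is what turns the weak inequality into a strict one.
\<close>

lemma choose_mult_card_filling_le:
  "(m + 2 choose 2) * card (filling {1..m} n) \<le> card (overfull {1..m+2} (n+1))"
proof -
  define B where "B = {1..m+2}"
  define Ps where "Ps = {P. P \<subseteq> B \<and> card P = 2}"
  define ext :: "nat set \<times> (nat \<Rightarrow> nat) \<Rightarrow> nat \<Rightarrow> nat"
    where "ext = (\<lambda>(P, f) j. if j \<in> P then 0 else f j)"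
  have finB: "finite B" by (simp add: B_def)
  have finPs: "finite Ps" by (simp add: Ps_def B_def)
  have cardPs: "card Ps = (m + 2 choose 2)"
    unfolding Ps_def using n_subsets[OF finB, of 2] by (simp add: B_def)
  have "(m + 2 choose 2) * card (filling {1..m} n) = (\<Sum>P\<in>Ps. card (filling {1..m} n))"
    by (simp add: cardPs)
  also have "\<dots> \<le> (\<Sum>P\<in>Ps. card (filling (B - P) n))"
  proof (rule sum_mono)
    fix P assume "P \<in> Ps"
    then have "card (B - P) = m"
      by (subst card_Diff_subset) (auto simp: Ps_def B_def intro: finite_subset)
    then show "card (filling {1..m} n) \<le> card (filling (B - P) n)"
      using finB by (intro card_filling_le) auto
  qed
  also have "\<dots> = card (SIGMA P:Ps. filling (B - P) n)"
    using finPs finB by simp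
  also have "\<dots> \<le> card (overfull B (n+1))"
  proof (rule card_inj_on_le)
    show "finite (overfull B (n+1))"
      using finB by (simp add: overfull_def finite_PiE)
    have zero: "{j\<in>B. ext (P, f) j = 0} = P" if "P \<in> Ps" "f \<in> filling (B - P) n" for P f
      using that by (force simp: ext_def Ps_def filling_def PiE_iff)
    show "inj_on ext (SIGMA P:Ps. filling (B - P) n)"
    proof (rule inj_onI, clarify)
      fix P f Q g
      assume P: "P \<in> Ps" and f: "f \<in> filling (B - P) n"
        and Q: "Q \<in> Ps" and g: "g \<in> filling (B - Q) n" and eq: "ext (P, f) = ext (Q, g)"
      have "P = Q" using zero[OF P f] zero[OF Q g] eq by simp
      moreover have "f = g"
      proof (rule PiE_ext)
        show "f \<in> (B - P) \<rightarrow>\<^sub>E {1..n}" "g \<in> (B - P) \<rightarrow>\<^sub>E {1..n}"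
          using f g \<open>P = Q\<close> by (simp_all add: filling_def)
        fix j assume "j \<in> B - P"
        then show "f j = g j" using fun_cong[OF eq, of j] \<open>P = Q\<close> by (simp add: ext_def)
      qed
      ultimately show "P = Q \<and> f = g" by simp
    qed
    show "ext ` (SIGMA P:Ps. filling (B - P) n) \<subseteq> overfull B (n+1)"
    proof clarify
      fix P f assume P: "P \<in> Ps" and f: "f \<in> filling (B - P) n"
      have finP: "finite P" and PB: "P \<subseteq> B" and "card P = 2"
        using P finB by (auto simp: Ps_def intro: finite_subset)
      have "t < card {j\<in>B. ext (P, f) j < t}" if t: "t \<in> {1..n+1}" for t
      proof -
        have "{j\<in>B. ext (P, f) j < t} = P \<union> {j\<in>B-P. f j \<le> t - 1}"
          using t PB by (auto simp: ext_def)
        moreover have "card (P \<union> {j\<in>B-P. f j \<le> t - 1}) = 2 + card {j\<in>B-P. f j \<le> t - 1}"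
          using finP finB \<open>card P = 2\<close> by (subst card_Un_disjoint) auto
        moreover have "t - 1 \<le> card {j\<in>B-P. f j \<le> t - 1}"
        proof (cases "t = 1")
          case False
          then have "t - 1 \<in> {1..n}" using t by auto
          then show ?thesis using f unfolding filling_def by blast
        qed simp
        ultimately show ?thesis by simp
      qed
      moreover have "ext (P, f) \<in> B \<rightarrow>\<^sub>E {..<n+1}"
        using f PB by (auto simp: ext_def filling_def PiE_iff extensional_def le_imp_less_Suc
            simp flip: Suc_eq_plus1)
      ultimately show "ext (P, f) \<in> overfull B (n+1)" by (simp add: overfull_def)
    qed
  qed
  finally show ?thesis by (simp add: B_def)
qed

text \<open>
  The two counting bounds with \<open>N = n + 1\<close> and \<open>m + 2\<close> drivers combine to
  \<open>(m + 2)(m + 1) |filling| \<le> 2 (m + 1 - n) (n + 1)\<^bsup>m + 1\<^esup>\<close>. If \<open>m < n\<close>, there are no filling assignments;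
  the maximum with \<open>0\<close> makes one formula valid in both cases.
\<close>

lemma filling_ratio_le:
  assumes "n \<ge> 1"
  shows "real (card (filling {1..m} n)) / real n ^ m
       \<le> 2 * max 0 (real m / real n - 1 + 1 / real n) * exp (real m / real n)"
proof (cases "m < n")
  case True
  have "f \<notin> filling {1..m} n" for f
  proof
    assume "f \<in> filling {1..m} n"
    then have "n \<le> card {j\<in>{1..m}. f j \<le> n}" using assms by (simp add: filling_def)
    also have "\<dots> \<le> card {1..m}" by (rule card_mono) auto
    finally show False using True by simp
  qed
  then have "filling {1..m} n = {}" by blast
  then show ?thesis by simp
next
  case False
  define w where "w = card (filling {1..m} n)"
  have npos: "real n > 0" using assms by simp
  have "(n + 1) * ((m + 2 choose 2) * w) \<le> (n + 1) * card (overfull {1..m+2} (n+1))"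
    using choose_mult_card_filling_le[of m n] unfolding w_def by (rule mult_le_mono2)
  also have "\<dots> \<le> (m + 2 - (n + 1)) * (n + 1) ^ (m + 2)"
    using card_overfull_le[of "{1..m+2}" "n+1"] by simp
  also have "\<dots> = (n + 1) * ((m + 1 - n) * (n + 1) ^ (m + 1))"
  proof -
    have "m + 2 = Suc (m + 1)" "Suc (m + 1) - (n + 1) = m + 1 - n" by simp_all
    then show ?thesis by (simp only: power_Suc mult.left_commute)
  qed
  finally have "(m + 2 choose 2) * w \<le> (m + 1 - n) * (n + 1) ^ (m + 1)"
    by (subst (asm) mult_le_cancel1) simp
  then have "2 * ((m + 2 choose 2) * w) \<le> 2 * ((m + 1 - n) * (n + 1) ^ (m + 1))" by simp
  moreover have "2 * (m + 2 choose 2) = (m + 2) * (m + 1)"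
    by (simp add: choose_two algebra_simps)
  ultimately have "(m + 2) * (m + 1) * w \<le> 2 * ((m + 1 - n) * (n + 1) ^ (m + 1))"
    by (metis mult.assoc)
  then have "real ((m + 2) * (m + 1) * w) \<le> real (2 * ((m + 1 - n) * (n + 1) ^ (m + 1)))"
    by (simp only: of_nat_le_iff)
  moreover have "real (m + 1 - n) = real m + 1 - real n" using False by simp
  ultimately have main: "(real m + 2) * (real m + 1) * w
      \<le> 2 * (real m + 1 - real n) * (real n + 1) ^ (m + 1)"
    by (simp only: of_nat_mult of_nat_power of_nat_add of_nat_numeral of_nat_1 mult.assoc)
  have "(real n + 1) * real n * w \<le> (real m + 2) * (real m + 1) * w"
    using False by (intro mult_right_mono mult_mono) auto
  also note main
  finally have "(real n + 1) * (real n * w) \<le> (real n + 1) * (2 * (real m + 1 - real n) * (real n + 1) ^ m)"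
    by (simp only: mult_ac power_add power_one_right)
  then have "real n * w \<le> 2 * (real m + 1 - real n) * (real n + 1) ^ m"
    by (subst (asm) mult_le_cancel_left_pos) auto
  then have "w / real n ^ m \<le> 2 * ((real m + 1 - real n) / real n) * ((real n + 1) ^ m / real n ^ m)"
    using npos by (simp add: field_simps)
  also have "\<dots> = 2 * (real m / real n - 1 + 1 / real n) * (1 + 1 / real n) ^ m"
    using npos by (simp add: field_simps flip: power_divide)
  also have "\<dots> \<le> 2 * max 0 (real m / real n - 1 + 1 / real n) * exp (real m / real n)"
  proof (rule mult_mono)
    show "2 * (real m / real n - 1 + 1 / real n) \<le> 2 * max 0 (real m / real n - 1 + 1 / real n)"
      by (intro mult_left_mono) auto
    have "(1 + 1 / real n) ^ m \<le> exp (1 / real n) ^ m"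
      by (intro power_mono) (auto simp: exp_ge_add_one_self)
    then show "(1 + 1 / real n) ^ m \<le> exp (real m / real n)"
      by (simp flip: exp_of_nat_mult)
  qed auto
  finally show ?thesis by (simp add: w_def)
qed

section \<open>The lower bound by exponential moments\<close>

text \<open>
  Chernoff's method with weight \<open>1/2\<close>: the weight \<open>(1/2)\<close> to the number of drivers preferring the
  first \<open>i\<close> spaces is at least \<open>(1/2)\<^sup>i\<close> on the assignments counted here, and its sum over all
  assignments factorizes over the drivers, each contributing \<open>n - i/2\<close>.
\<close>

lemma card_few_preferences_le:
  assumes "i \<le> n" "n \<ge> 1"
  shows "real (card {f \<in> assignments n m. card {j\<in>{1..m}. f j \<le> i} < i})
       \<le> real n ^ m * (2 * exp (- (real m / real n) / 2)) ^ i"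
proof -
  define cnt where "cnt f = card {j\<in>{1..m}. f j \<le> i}" for f :: "nat \<Rightarrow> nat"
  define bad where "bad = {f \<in> assignments n m. cnt f < i}"
  have fin: "finite (assignments n m)" by (simp add: assignments_def finite_PiE)
  have "card bad * (1/2::real) ^ i = (\<Sum>f\<in>bad. (1/2) ^ i)" by simp
  also have "\<dots> \<le> (\<Sum>f\<in>bad. (1/2) ^ cnt f)"
    by (intro sum_mono power_decreasing) (auto simp: bad_def)
  also have "\<dots> \<le> (\<Sum>f\<in>assignments n m. (1/2) ^ cnt f)"
    using fin by (intro sum_mono2) (auto simp: bad_def)
  also have "\<dots> = (\<Sum>f\<in>assignments n m. \<Prod>j\<in>{1..m}. if f j \<le> i then 1/2 else 1)"
    by (simp add: cnt_def prod.If_cases Int_def)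
  also have "\<dots> = (\<Prod>j\<in>{1..m}. \<Sum>a\<in>{1..n}. if a \<le> i then 1/2 else 1)"
    unfolding assignments_def by (subst prod_sum_PiE) auto
  also have "(\<Sum>a\<in>{1..n}. if a \<le> i then 1/2 else 1) = real n - real i / 2"
  proof -
    have "{1..n} \<inter> {a. a \<le> i} = {1..i}" "{1..n} \<inter> - {a. a \<le> i} = {i<..n}"
      using assms by auto
    then show ?thesis using assms by (simp add: sum.If_cases of_nat_diff)
  qed
  also have "real n - real i / 2 = real n * (1 - real i / (2 * real n))"
    using assms by (simp add: field_simps)
  also have "(\<Prod>j\<in>{1..m}. real n * (1 - real i / (2 * real n)))
      = real n ^ m * (1 - real i / (2 * real n)) ^ m"
    by (simp add: power_mult_distrib)
  also have "\<dots> \<le> real n ^ m * exp (- real i / (2 * real n)) ^ m"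
  proof (intro mult_left_mono power_mono)
    show "1 - real i / (2 * real n) \<le> exp (- real i / (2 * real n))"
      using exp_ge_add_one_self[of "- real i / (2 * real n)"] by simp
  qed (use assms in \<open>auto simp: field_simps\<close>)
  also have "exp (- real i / (2 * real n)) ^ m = exp (- (real m / real n) / 2) ^ i"
    by (simp add: mult_ac flip: exp_of_nat_mult)
  finally show ?thesis
    by (simp add: bad_def cnt_def power_divide power_mult_distrib field_simps)
qed

text \<open>A union bound over \<open>i\<close>, followed by the geometric series.\<close>

lemma filling_ratio_ge:
  assumes "n \<ge> 1" and q: "q = 2 * exp (- (real m / real n) / 2)" "q < 1"
  shows "1 - q / (1 - q) \<le> real (card (filling {1..m} n)) / real n ^ m"
proof -
  define bad where "bad i = {f \<in> assignments n m. card {j\<in>{1..m}. f j \<le> i} < i}" for i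
  have fin: "finite (assignments n m)" by (simp add: assignments_def finite_PiE)
  have "assignments n m \<subseteq> filling {1..m} n \<union> (\<Union>i\<in>{1..n}. bad i)"
    by (auto simp: filling_def assignments_def bad_def)
  then have "card (assignments n m) \<le> card (filling {1..m} n \<union> (\<Union>i\<in>{1..n}. bad i))"
    using fin by (intro card_mono) (auto simp: bad_def)
  also have "\<dots> \<le> card (filling {1..m} n) + (\<Sum>i\<in>{1..n}. card (bad i))"
    by (intro order_trans[OF card_Un_le] add_left_mono card_UN_le) auto
  finally have "real n ^ m \<le> card (filling {1..m} n) + (\<Sum>i\<in>{1..n}. real (card (bad i)))"
    unfolding card_assignments by (simp flip: of_nat_power of_nat_sum of_nat_add)
  also have "(\<Sum>i\<in>{1..n}. real (card (bad i))) \<le> (\<Sum>i\<in>{1..n}. real n ^ m * q ^ i)"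
    unfolding bad_def q(1) using assms(1) by (intro sum_mono card_few_preferences_le) auto
  also have "\<dots> = real n ^ m * (\<Sum>i\<in>{1..n}. q ^ i)" by (simp add: sum_distrib_left)
  also have "(\<Sum>i\<in>{1..n}. q ^ i) \<le> q / (1 - q)"
  proof -
    have "q > 0" by (simp add: q(1))
    then have "(q - q ^ Suc n) / (1 - q) \<le> q / (1 - q)"
      using q(2) by (intro divide_right_mono) auto
    then show ?thesis using q(2) assms(1) by (simp add: sum_gp)
  qed
  finally have "real n ^ m \<le> card (filling {1..m} n) + real n ^ m * (q / (1 - q))"
    by (simp add: mult_left_mono)
  then show ?thesis using assms(1) by (simp add: field_simps)
qed

lemma filling_ratio_le_1: "real (card (filling {1..m} n)) / real n ^ m \<le> 1"
proof -
  have "card (filling {1..m} n) \<le> card (assignments n m)"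
    by (intro card_mono) (auto simp: filling_eq_all_occupied assignments_def finite_PiE)
  then have "real (card (filling {1..m} n)) \<le> real n ^ m"
    unfolding card_assignments by (simp flip: of_nat_power)
  then show ?thesis by (intro divide_le_eq_1[THEN iffD2]) (auto simp: zero_less_power_eq)
qed

section \<open>The two regimes\<close>

theorem corollary11:
  fixes m :: "nat \<Rightarrow> nat"
  shows "(\<forall>n\<ge>1. measure_pmf.prob (pmf_of_set (assignments n (m n)))
                  {f. occupied n f (m n) = {1..n}}
                = real (cp n (m n) (int (m n) - int n)) / real n ^ m n) \<and>
         ((\<exists>L\<le>1. (\<lambda>n. real (m n) / real n) \<longlonglongrightarrow> L) \<longrightarrow>
            (\<lambda>n. real (cp n (m n) (int (m n) - int n)) / real n ^ m n) \<longlonglongrightarrow> 0) \<and>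
         (filterlim (\<lambda>n. real (m n) / real n) at_top sequentially \<longrightarrow>
            (\<lambda>n. real (cp n (m n) (int (m n) - int n)) / real n ^ m n) \<longlonglongrightarrow> 1)"
  unfolding cp_eq_card_filling
proof (intro conjI impI allI)
  fix n :: nat assume "n \<ge> 1"
  then show "measure_pmf.prob (pmf_of_set (assignments n (m n)))
               {f. occupied n f (m n) = {1..n}}
             = real (card (filling {1..m n} n)) / real n ^ m n"
    by (rule prob_all_occupied)
next
  assume "\<exists>L\<le>1. (\<lambda>n. real (m n) / real n) \<longlonglongrightarrow> L"
  then obtain L where "L \<le> 1" and L: "(\<lambda>n. real (m n) / real n) \<longlonglongrightarrow> L" by blast
  have "(\<lambda>n. 2 * max 0 (real (m n) / real n - 1 + 1 / real n) * exp (real (m n) / real n))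
      \<longlonglongrightarrow> 2 * max 0 (L - 1 + 0) * exp L"
    by (intro tendsto_intros L lim_1_over_n)
  then have lim: "(\<lambda>n. 2 * max 0 (real (m n) / real n - 1 + 1 / real n) * exp (real (m n) / real n)) \<longlonglongrightarrow> 0"
    using \<open>L \<le> 1\<close> by simp
  show "(\<lambda>n. real (card (filling {1..m n} n)) / real n ^ m n) \<longlonglongrightarrow> 0"
  proof (rule tendsto_sandwich[OF _ _ tendsto_const lim])
    show "\<forall>\<^sub>F n in sequentially. real (card (filling {1..m n} n)) / real n ^ m n
        \<le> 2 * max 0 (real (m n) / real n - 1 + 1 / real n) * exp (real (m n) / real n)"
      using eventually_ge_at_top[of 1] by eventually_elim (rule filling_ratio_le)
  qed simp
next
  assume top: "filterlim (\<lambda>n. real (m n) / real n) at_top sequentially"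
  define q where "q n = 2 * exp (- (real (m n) / real n) / 2)" for n
  have "((\<lambda>x. 2 * exp (- x / 2)) \<longlongrightarrow> (0::real)) at_top"
    by real_asymp
  from filterlim_compose[OF this top] have q: "q \<longlonglongrightarrow> 0"
    by (simp add: q_def[abs_def])
  then have "(\<lambda>n. 1 - q n / (1 - q n)) \<longlonglongrightarrow> 1 - 0 / (1 - 0)"
    by (intro tendsto_intros) auto
  then have lim: "(\<lambda>n. 1 - q n / (1 - q n)) \<longlonglongrightarrow> 1" by simp
  have "\<forall>\<^sub>F n in sequentially. q n < 1"
    using q by (rule order_tendstoD) simp
  then have lower: "\<forall>\<^sub>F n in sequentially.
      1 - q n / (1 - q n) \<le> real (card (filling {1..m n} n)) / real n ^ m n"
    using eventually_ge_at_top[of 1]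
    by eventually_elim (rule filling_ratio_ge, simp_all add: q_def)
  show "(\<lambda>n. real (card (filling {1..m n} n)) / real n ^ m n) \<longlonglongrightarrow> 1"
    by (rule tendsto_sandwich[OF lower _ lim tendsto_const], intro always_eventually allI)
      (rule filling_ratio_le_1)
qed

end
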